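(* Let $p\ge1$, $r\ge1$, $n\ge1$ be integers, let $a,b\in\mathbb{R}^n$ with $y=\sum_{i=1}^n a_ib_i\ne0$, and let $\widehat{y}$ be the result of computing the inner product $y$ with limited-precision stochastic rounding $\mathrm{SR}_{p,r}$: $\widehat{t}_k=\mathrm{SR}_{p,r}(a_kb_k)$ for $k=1,\ldots,n$, $\widehat{s}_1=\widehat{t}_1$, $\widehat{s}_k=\mathrm{SR}_{p,r}(\widehat{s}_{k-1}+\widehat{t}_k)$ for $k=2,\ldots,n$, and $\widehat{y}=\widehat{s}_n$. Then, for any $0<\lambda<1$, $$\frac{|\widehat{y}-y|}{|y|}\le \kappa(a\circ b)\left(\sqrt{u_p\,\gamma_{2n}(u_p)}\,\sqrt{\ln(2/\lambda)}+\gamma_{n}(u_p+u_{p+r})-\gamma_{n}(u_p)\right)$$ with probability at least $1-\lambda$.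
   Context: Notation: $u_q=2^{1-q}$ for an integer $q\ge1$; $\gamma_m(u)=(1+u)^m-1$; $a\circ b=(a_1b_1,\ldots,a_nb_n)$ is the Hadamard product and $\kappa(a\circ b)=\dfrac{\sum_{i=1}^n|a_ib_i|}{\left|\sum_{i=1}^n a_ib_i\right|}$ is the condition number of the inner product. Floating-point numbers: $\mathcal{F}$ is the precision-$p$ binary floating-point system, i.e. the set of $0$ and all real numbers $(-1)^s 2^e m$ with $s\in\{0,1\}$, $e$ an integer exponent, and $m\in[1,2)$ having at most $p$ significant bits. Standard model: no underflow or overflow occurs (the exponent range may be regarded as unlimited). For $x\in\mathbb{R}$, $\lceil x\rceil_p=\min\{y\in\mathcal{F}:y\ge x\}$ and $\lfloor x\rfloor_p=\max\{y\in\mathcal{F}:y\le x\}$. For $x\neq0$ written uniquely as $x=(-1)^s2^em$ with $m\in[1,2)$ real, $\mathrm{ulp}_p(x)=2^{e-p+1}$, and $\mathrm{fl}_{p+r}(x)$ is $x$ with the binary expansion of its significand $m$ truncated to the first $p+r$ significant bits; $\mathrm{fl}_{p+r}(0)=0$. Limited-precision stochastic rounding with $r$ random bits: $\mathrm{SR}_{p,r}(0)=0$, and for $x\ne0$, $\mathrm{SR}_{p,r}(x)$ is the random variable equal to $\lceil x\rceil_p$ with probability $q_r(x)$ and to $\lfloor x\rfloor_p$ with probability $1-q_r(x)$, where $q_r(x)=(\mathrm{fl}_{p+r}(x)-\lfloor x\rfloor_p)/\mathrm{ulp}_p(x)$. In an algorithm, the inputs are deterministic and each rounding, conditionally on all previous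 roundings, has this two-point distribution with $x$ the exact result of the current operation. *)

theory Defs
  imports "HOL-Probability.Probability"
begin

definition u_roundoff :: "nat \<Rightarrow> real" where
  "u_roundoff q = 2 powi (1 - int q)"

definition gamma_err :: "nat \<Rightarrow> real \<Rightarrow> real" where
  "gamma_err m u = (1 + u) ^ m - 1"

text \<open>Vectors in dimension \<open>n\<close> are functions on \<open>nat\<close> of which only the values on \<open>{1..n}\<close> are used.\<close>

definition hadamard :: "(nat \<Rightarrow> real) \<Rightarrow> (nat \<Rightarrow> real) \<Rightarrow> nat \<Rightarrow> real" where
  "hadamard a b = (\<lambda>i. a i * b i)"

definition cond_number :: "nat \<Rightarrow> (nat \<Rightarrow> real) \<Rightarrow> real" where
  "cond_number n c = (\<Sum>i=1..n. \<bar>c i\<bar>) / \<bar>\<Sum>i=1..n. c i\<bar>"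

text \<open>
  The exponent range is unlimited. For \<open>p \<ge> 1\<close> the significand \<open>m \<in> [1, 2)\<close> has at most \<open>p\<close>
  significant bits iff \<open>m * 2 ^ (p - 1)\<close> is an integer.
\<close>

definition fp_numbers :: "nat \<Rightarrow> real set" where
  "fp_numbers p = insert 0 {(-1) ^ s * 2 powi e * m | (s :: nat) (e :: int) (m :: real).
     s \<in> {0, 1} \<and> 1 \<le> m \<and> m < 2 \<and> m * 2 ^ (p - 1) \<in> \<int>}"

definition ceil_fp :: "nat \<Rightarrow> real \<Rightarrow> real" where
  "ceil_fp p x = (LEAST y. y \<in> fp_numbers p \<and> y \<ge> x)"

definition floor_fp :: "nat \<Rightarrow> real \<Rightarrow> real" where
  "floor_fp p x = (GREATEST y. y \<in> fp_numbers p \<and> y \<le> x)"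

text \<open>
  Exponent and significand in \<open>x = (-1)^s * 2^e * m\<close> with \<open>m \<in> [1, 2)\<close>, for \<open>x \<noteq> 0\<close>.
  That these are the right \<open>e\<close> and \<open>m\<close> is shown by the two lemmas below.
\<close>

definition fp_exponent :: "real \<Rightarrow> int" where
  "fp_exponent x = \<lfloor>log 2 \<bar>x\<bar>\<rfloor>"

definition fp_significand :: "real \<Rightarrow> real" where
  "fp_significand x = \<bar>x\<bar> / 2 powi fp_exponent x"

lemma fp_decomposition:
  assumes "x \<noteq> 0"
  shows "x = sgn x * 2 powi fp_exponent x * fp_significand x"
    and "1 \<le> fp_significand x" and "fp_significand x < 2"
proof -
  have pos: "\<bar>x\<bar> > 0" using assms by simp
  have eq: "2 powr (of_int (fp_exponent x)) = (2::real) powi fp_exponent x"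
    by (simp add: powr_real_of_int')
  have x: "2 powr (log 2 \<bar>x\<bar>) = \<bar>x\<bar>" using pos by simp
  have lo: "2 powi fp_exponent x \<le> \<bar>x\<bar>"
    unfolding eq[symmetric] by (subst x[symmetric]) (simp add: fp_exponent_def)
  have "2 powr (log 2 \<bar>x\<bar>) < (2::real) powr (of_int (fp_exponent x) + 1)"
    by (rule powr_less_mono) (simp_all add: fp_exponent_def)
  hence hi: "\<bar>x\<bar> < 2 * 2 powi fp_exponent x"
    by (simp only: x powr_add eq) simp
  have w: "(2::real) powi fp_exponent x > 0" by simp
  show "x = sgn x * 2 powi fp_exponent x * fp_significand x"
    using w by (simp add: fp_significand_def sgn_mult_abs)
  show "1 \<le> fp_significand x" "fp_significand x < 2"
    using lo hi w by (simp_all add: fp_significand_def field_simps)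
qed

lemma fp_decomposition_unique:
  assumes "x = (-1) ^ (s::nat) * 2 powi e * m" and "1 \<le> m" and "m < 2"
  shows "fp_exponent x = e" and "fp_significand x = m"
proof -
  have ax: "\<bar>x\<bar> = 2 powi e * m"
    using assms by (simp add: abs_mult power_abs)
  have "log 2 \<bar>x\<bar> = of_int e + log 2 m"
    unfolding ax using assms by (subst log_mult) (auto simp: powr_real_of_int'[symmetric])
  moreover have "0 \<le> log 2 m" "log 2 m < 1" using assms by auto
  ultimately show e: "fp_exponent x = e" unfolding fp_exponent_def by linarith
  show "fp_significand x = m" unfolding fp_significand_def e ax by simp
qed

definition ulp :: "nat \<Rightarrow> real \<Rightarrow> real" where
  "ulp p x = 2 powi (fp_exponent x - int p + 1)"

text \<open>
  The significand is truncated to its first \<open>q \<ge> 1\<close> bits (one before and \<open>q - 1\<close> after the binary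
  point), so rounding is towards zero for either sign.
\<close>

definition fl_trunc :: "nat \<Rightarrow> real \<Rightarrow> real" where
  "fl_trunc q x = (if x = 0 then 0 else
     sgn x * 2 powi fp_exponent x * (of_int \<lfloor>fp_significand x * 2 ^ (q - 1)\<rfloor> / 2 ^ (q - 1)))"

definition sr_prob :: "nat \<Rightarrow> nat \<Rightarrow> real \<Rightarrow> real" where
  "sr_prob p r x = (fl_trunc (p + r) x - floor_fp p x) / ulp p x"

text \<open>
  \<open>bernoulli_pmf\<close> clips its parameter to \<open>[0, 1]\<close>; by \<open>sr_prob_bounds\<close> below the clipping is never
  active.
\<close>

definition SR :: "nat \<Rightarrow> nat \<Rightarrow> real \<Rightarrow> real pmf" where
  "SR p r x = (if x = 0 then return_pmf 0 else
     map_pmf (\<lambda>up. if up then ceil_fp p x else floor_fp p x) (bernoulli_pmf (sr_prob p r x)))"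

text \<open>
  The law of the \<open>k\<close>-th partial sum. Each rounding draws fresh randomness, with the law prescribed by
  the exact result of the current operation; the value at \<open>k = 0\<close> is a dummy.
\<close>

fun sr_partial_sum :: "nat \<Rightarrow> nat \<Rightarrow> (nat \<Rightarrow> real) \<Rightarrow> (nat \<Rightarrow> real) \<Rightarrow> nat \<Rightarrow> real pmf" where
  "sr_partial_sum p r a b 0 = return_pmf 0"
| "sr_partial_sum p r a b (Suc 0) = SR p r (a 1 * b 1)"
| "sr_partial_sum p r a b (Suc (Suc k)) =
     do {
       s \<leftarrow> sr_partial_sum p r a b (Suc k);
       t \<leftarrow> SR p r (a (Suc (Suc k)) * b (Suc (Suc k)));
       SR p r (s + t)
     }"

definition sr_inner_product :: "nat \<Rightarrow> nat \<Rightarrow> nat \<Rightarrow> (nat \<Rightarrow> real) \<Rightarrow> (nat \<Rightarrow> real) \<Rightarrow> real pmf" where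
  "sr_inner_product p r n a b = sr_partial_sum p r a b n"


text \<open>Closed forms of the directed roundings, and the bounds on \<open>sr_prob\<close>.\<close>

lemma fp_numbers_uminus: "- y \<in> fp_numbers p \<longleftrightarrow> y \<in> fp_numbers p"
proof -
  have *: "- y \<in> fp_numbers p" if y: "y \<in> fp_numbers p" for y
  proof (cases "y = 0")
    case False
    then obtain s e m where h: "y = (-1) ^ s * 2 powi e * m" "s \<in> {0, 1::nat}" "1 \<le> m" "m < 2"
      "m * 2 ^ (p - 1) \<in> \<int>"
      using y unfolding fp_numbers_def by blast
    have "- y = (-1) ^ (1 - s) * 2 powi e * m" "1 - s \<in> {0, 1}" using h by auto
    then show ?thesis using h(3-5) unfolding fp_numbers_def by blast
  qed (use y in simp)
  from *[of y] *[of "- y"] show ?thesis by auto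
qed

lemma fp_numbers_pos_cases:
  assumes "y \<in> fp_numbers p" and "y > 0"
  obtains e m where "y = 2 powi e * m" "1 \<le> m" "m < 2" "m * 2 ^ (p - 1) \<in> \<int>"
proof -
  obtain s e m where h: "y = (-1) ^ s * 2 powi e * m" "s \<in> {0, 1::nat}" "1 \<le> m" "m < 2"
      "m * 2 ^ (p - 1) \<in> \<int>"
    using assms unfolding fp_numbers_def by blast
  have w: "(2::real) powi e > 0" by simp
  have "s = 0"
  proof (rule ccontr)
    assume "s \<noteq> 0"
    hence "y = - (2 powi e * m)" using h(1,2) by simp
    moreover have "2 powi e * m > 0" using w h(3) by simp
    ultimately show False using assms(2) by linarith
  qed
  thus ?thesis using that[of e m] h by simp
qed

lemma fp_numbersI_int:
  assumes "p \<ge> 1" and "2 ^ (p - 1) \<le> k" and "k \<le> 2 ^ p"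
  shows "of_int k * 2 powi (e - int p + 1) \<in> fp_numbers p"
proof -
  have sc: "(2::real) powi (e - int p + 1) * 2 ^ (p - 1) = 2 powi e" for e
  proof -
    have "(2::real) ^ (p - 1) = 2 powi (int p - 1)"
      using assms(1) by (simp add: power_int_def nat_diff_distrib)
    thus ?thesis by (simp add: power_int_add[symmetric])
  qed
  show ?thesis
  proof (cases "k = 2 ^ p")
    case False
    define m :: real where "m = of_int k / 2 ^ (p - 1)"
    have k: "(2::real) ^ (p - 1) \<le> of_int k" "of_int k < (2::real) * 2 ^ (p - 1)"
    proof -
      have "of_int (2 ^ (p - 1)) \<le> (of_int k :: real)" using assms(2) by (simp only: of_int_le_iff)
      thus "(2::real) ^ (p - 1) \<le> of_int k" by simp
      have "k < 2 ^ p" using assms(3) False by simp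
      hence "k < 2 * 2 ^ (p - 1)" using assms(1) by (simp add: power_eq_if split: if_splits)
      hence "of_int k < (of_int (2 * 2 ^ (p - 1)) :: real)" by (simp only: of_int_less_iff)
      thus "of_int k < (2::real) * 2 ^ (p - 1)" by simp
    qed
    have "of_int k * 2 powi (e - int p + 1) = (-1) ^ (0::nat) * 2 powi e * m"
      unfolding m_def sc[symmetric, of e] by simp
    moreover have "1 \<le> m" "m < 2" "m * 2 ^ (p - 1) \<in> \<int>"
      using k by (simp_all add: m_def field_simps)
    ultimately show ?thesis unfolding fp_numbers_def by blast
  next
    case True
    have "(2::real) ^ p = 2 * 2 ^ (p - 1)" using assms(1) by (simp add: power_eq_if)
    hence "of_int k * 2 powi (e - int p + 1) = 2 * (2 powi (e - int p + 1) * 2 ^ (p - 1) :: real)"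
      using True by simp
    also have "\<dots> = (-1) ^ (0::nat) * 2 powi (e + 1) * (1::real)"
      unfolding sc by (simp add: power_int_add)
    finally show ?thesis unfolding fp_numbers_def
      by (intro insertI2 CollectI exI[of _ "0::nat"] exI[of _ "e + 1"] exI[of _ "1::real"]) auto
  qed
qed

lemma ulp_pos: "ulp p x > 0"
  by (simp add: ulp_def)

lemma fp_exponent_uminus: "fp_exponent (- x) = fp_exponent x"
  by (simp add: fp_exponent_def)

lemma ulp_uminus: "ulp p (- x) = ulp p x"
  by (simp add: ulp_def fp_exponent_uminus)

lemma div_ulp:
  assumes "p \<ge> 1" and "x \<noteq> 0"
  shows "x / ulp p x = sgn x * (fp_significand x * 2 ^ (p - 1))"
proof -
  have "(2::real) powi (fp_exponent x) = ulp p x * 2 ^ (p - 1)"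
  proof -
    have "(2::real) ^ (p - 1) = 2 powi (int p - 1)"
      using assms(1) by (simp add: power_int_def nat_diff_distrib)
    thus ?thesis unfolding ulp_def by (simp add: power_int_add[symmetric])
  qed
  thus ?thesis
    using ulp_pos[of p x] by (subst fp_decomposition(1)[OF assms(2)]) simp
qed

lemma fp_above_multiple_ulp:
  assumes "p \<ge> 1" and "x > 0" and "y \<in> fp_numbers p" and "2 powi fp_exponent x \<le> y"
  shows "y / ulp p x \<in> \<int>"
proof -
  have "(2::real) powi fp_exponent x > 0" by simp
  hence "y > 0" using assms(4) by linarith
  then obtain e m where h: "y = 2 powi e * m" "1 \<le> m" "m < 2" "m * 2 ^ (p - 1) \<in> \<int>"
    using fp_numbers_pos_cases[OF assms(3)] by metis
  have "fp_exponent x \<le> e"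
  proof (rule ccontr)
    assume "\<not> fp_exponent x \<le> e"
    hence "(2::real) powi (e + 1) \<le> 2 powi fp_exponent x" by (intro power_int_increasing) auto
    moreover have "y < 2 powi (e + 1)" using h by (simp add: power_int_add)
    ultimately show False using assms(4) by linarith
  qed
  then obtain j where j: "e = fp_exponent x + int j" by (metis zle_iff_zadd)
  have "(2::real) ^ (p - 1) = 2 powi (int p - 1)"
    using assms(1) by (simp add: power_int_def nat_diff_distrib)
  hence "(2::real) powi e = ulp p x * 2 ^ (p - 1) * 2 ^ j"
    unfolding ulp_def j by (simp add: power_int_add[symmetric] flip: power_int_of_nat)
  hence "y / ulp p x = 2 ^ j * (m * 2 ^ (p - 1))"
    using ulp_pos[of p x] by (simp add: h(1))
  thus ?thesis using h(4) by (metis Ints_mult Ints_numeral Ints_power)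
qed

lemma floor_ceil_fp_pos:
  assumes p: "p \<ge> 1" and x: "x > 0"
  defines "w \<equiv> ulp p x"
  shows "of_int \<lfloor>x / w\<rfloor> * w \<in> fp_numbers p" "of_int \<lfloor>x / w\<rfloor> * w \<le> x"
    "\<And>y. y \<in> fp_numbers p \<Longrightarrow> y \<le> x \<Longrightarrow> y \<le> of_int \<lfloor>x / w\<rfloor> * w"
    "of_int \<lceil>x / w\<rceil> * w \<in> fp_numbers p" "x \<le> of_int \<lceil>x / w\<rceil> * w"
    "\<And>y. y \<in> fp_numbers p \<Longrightarrow> x \<le> y \<Longrightarrow> of_int \<lceil>x / w\<rceil> * w \<le> y"
proof -
  have w: "w > 0" unfolding w_def by (rule ulp_pos)
  have t: "x / w = fp_significand x * 2 ^ (p - 1)"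
    unfolding w_def using div_ulp[OF p, of x] x by simp
  have m: "1 \<le> fp_significand x" "fp_significand x < 2" using fp_decomposition[of x] x by auto
  have lo: "2 ^ (p - 1) \<le> x / w" using m unfolding t by simp
  have "x / w < 2 * 2 ^ (p - 1)" using m unfolding t by simp
  also have "(2::real) * 2 ^ (p - 1) = 2 ^ p" using p by (simp add: power_eq_if)
  finally have hi: "x / w < 2 ^ p" .
  have lo': "2 ^ (p - 1) \<le> \<lfloor>x / w\<rfloor>" using lo by (simp add: le_floor_iff)
  have hi': "\<lceil>x / w\<rceil> \<le> 2 ^ p" using hi by (simp add: ceiling_le_iff)
  have fc: "\<lfloor>x / w\<rfloor> \<le> \<lceil>x / w\<rceil>" by linarith
  have lo2: "2 ^ (p - 1) \<le> \<lceil>x / w\<rceil>" and hi2: "\<lfloor>x / w\<rfloor> \<le> 2 ^ p"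
    using lo' hi' fc by linarith+
  show "of_int \<lfloor>x / w\<rfloor> * w \<in> fp_numbers p"
    using fp_numbersI_int[OF p lo' hi2] unfolding w_def ulp_def .
  show "of_int \<lceil>x / w\<rceil> * w \<in> fp_numbers p"
    using fp_numbersI_int[OF p lo2 hi'] unfolding w_def ulp_def .
  have "of_int \<lfloor>x / w\<rfloor> \<le> x / w" by simp
  thus "of_int \<lfloor>x / w\<rfloor> * w \<le> x" using w by (simp only: pos_le_divide_eq)
  have "x / w \<le> of_int \<lceil>x / w\<rceil>" by simp
  thus "x \<le> of_int \<lceil>x / w\<rceil> * w" using w by (simp only: pos_divide_le_eq)
  have x_ge: "2 powi fp_exponent x \<le> x"
    using m(1) x by (simp add: fp_significand_def field_simps)
  have ex: "(2::real) powi fp_exponent x = 2 ^ (p - 1) * w"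
    using t w x by (simp add: fp_significand_def field_simps)
  have "of_int (2 ^ (p - 1)) \<le> (of_int \<lfloor>x / w\<rfloor> :: real)" using lo' by (simp only: of_int_le_iff)
  hence e_le: "2 powi fp_exponent x \<le> of_int \<lfloor>x / w\<rfloor> * w"
    unfolding ex using w by simp
  show "y \<le> of_int \<lfloor>x / w\<rfloor> * w" if y: "y \<in> fp_numbers p" "y \<le> x" for y
  proof (cases "2 powi fp_exponent x \<le> y")
    case True
    then obtain k where k: "y / w = of_int k"
      using fp_above_multiple_ulp[OF p x y(1)] unfolding w_def by (auto elim: Ints_cases)
    have "y / w \<le> x / w" using y(2) w by (simp add: divide_right_mono)
    hence "k \<le> \<lfloor>x / w\<rfloor>" unfolding k by (simp add: le_floor_iff)
    hence "y / w \<le> of_int \<lfloor>x / w\<rfloor>" unfolding k by simp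
    thus ?thesis using w by (simp only: pos_divide_le_eq)
  qed (use e_le in linarith)
  show "of_int \<lceil>x / w\<rceil> * w \<le> y" if y: "y \<in> fp_numbers p" "x \<le> y" for y
  proof -
    obtain k where k: "y / w = of_int k"
      using fp_above_multiple_ulp[OF p x y(1)] x_ge y(2) unfolding w_def by (auto elim: Ints_cases)
    have "x / w \<le> y / w" using y(2) w by (simp add: divide_right_mono)
    hence "\<lceil>x / w\<rceil> \<le> k" unfolding k by (simp add: ceiling_le_iff)
    hence "of_int \<lceil>x / w\<rceil> \<le> y / w" unfolding k by simp
    thus ?thesis using w by (simp only: pos_le_divide_eq)
  qed
qed

lemma floor_fp_eq:
  assumes p: "p \<ge> 1" and x: "x \<noteq> 0"
  shows "floor_fp p x = of_int \<lfloor>x / ulp p x\<rfloor> * ulp p x"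
proof (cases "x > 0")
  case True
  show ?thesis unfolding floor_fp_def
    using floor_ceil_fp_pos[OF p True] by (intro Greatest_equality) auto
next
  case False
  hence x': "- x > 0" using x by simp
  have e: "of_int \<lfloor>x / ulp p x\<rfloor> * ulp p x = - (of_int \<lceil>- x / ulp p (- x)\<rceil> * ulp p (- x))"
    by (simp add: ulp_uminus ceiling_minus)
  note h = floor_ceil_fp_pos(4-6)[OF p x']
  show ?thesis unfolding floor_fp_def e
  proof (rule Greatest_equality)
    show "- (of_int \<lceil>- x / ulp p (- x)\<rceil> * ulp p (- x)) \<in> fp_numbers p \<and>
      - (of_int \<lceil>- x / ulp p (- x)\<rceil> * ulp p (- x)) \<le> x"
      using h(1,2) unfolding fp_numbers_uminus by linarith
    show "y \<le> - (of_int \<lceil>- x / ulp p (- x)\<rceil> * ulp p (- x))" if "y \<in> fp_numbers p \<and> y \<le> x" for y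
      using h(3)[of "- y"] that unfolding fp_numbers_uminus by linarith
  qed
qed

lemma ceil_fp_eq:
  assumes p: "p \<ge> 1" and x: "x \<noteq> 0"
  shows "ceil_fp p x = of_int \<lceil>x / ulp p x\<rceil> * ulp p x"
proof (cases "x > 0")
  case True
  show ?thesis unfolding ceil_fp_def
    using floor_ceil_fp_pos[OF p True] by (intro Least_equality) auto
next
  case False
  hence x': "- x > 0" using x by simp
  have e: "of_int \<lceil>x / ulp p x\<rceil> * ulp p x = - (of_int \<lfloor>- x / ulp p (- x)\<rfloor> * ulp p (- x))"
    by (simp add: ulp_uminus floor_minus)
  note h = floor_ceil_fp_pos(1-3)[OF p x']
  show ?thesis unfolding ceil_fp_def e
  proof (rule Least_equality)
    show "- (of_int \<lfloor>- x / ulp p (- x)\<rfloor> * ulp p (- x)) \<in> fp_numbers p \<and>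
      x \<le> - (of_int \<lfloor>- x / ulp p (- x)\<rfloor> * ulp p (- x))"
      using h(1,2) unfolding fp_numbers_uminus by linarith
    show "- (of_int \<lfloor>- x / ulp p (- x)\<rfloor> * ulp p (- x)) \<le> y" if "y \<in> fp_numbers p \<and> x \<le> y" for y
      using h(3)[of "- y"] that unfolding fp_numbers_uminus by linarith
  qed
qed

lemma sr_prob_bounds:
  assumes p: "p \<ge> 1" and x: "x \<noteq> 0"
  shows "0 \<le> sr_prob p r x" and "sr_prob p r x \<le> 1"
proof -
  define w where "w = ulp p x"
  define t where "t = fp_significand x * 2 ^ (p - 1)"
  define f where "f = (of_int \<lfloor>t * 2 ^ r\<rfloor> / 2 ^ r :: real)"
  have w: "w > 0" unfolding w_def by (rule ulp_pos)
  have xw: "x / w = sgn x * t" unfolding w_def t_def by (rule div_ulp[OF p x])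
  have pr: "(2::real) ^ (p + r - 1) = 2 ^ (p - 1) * 2 ^ r"
    using p by (simp add: power_add[symmetric])
  have "(2::real) ^ (p - 1) = 2 powi (int p - 1)"
    using p by (simp add: power_int_def nat_diff_distrib)
  hence ew: "(2::real) powi fp_exponent x = w * 2 ^ (p - 1)"
    unfolding w_def ulp_def by (simp add: power_int_add[symmetric])
  have fl: "fl_trunc (p + r) x = sgn x * f * w"
    using x unfolding fl_trunc_def pr ew f_def t_def by (simp add: mult.assoc)
  have q: "sr_prob p r x = sgn x * f - of_int \<lfloor>sgn x * t\<rfloor>"
    unfolding sr_prob_def fl floor_fp_eq[OF p x] w_def[symmetric] xw
    using w by (simp add: field_simps)
  have f1: "f \<le> t"
    unfolding f_def by (simp add: divide_le_eq)
  have "\<lfloor>t\<rfloor> * 2 ^ r \<le> \<lfloor>t * 2 ^ r\<rfloor>" by (simp add: le_floor_iff)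
  hence "of_int (\<lfloor>t\<rfloor> * 2 ^ r) \<le> (of_int \<lfloor>t * 2 ^ r\<rfloor> :: real)" by (simp only: of_int_le_iff)
  hence f2: "of_int \<lfloor>t\<rfloor> \<le> f" unfolding f_def by (simp add: le_divide_eq)
  have "0 \<le> sr_prob p r x \<and> sr_prob p r x \<le> 1"
  proof (cases "x > 0")
    case True
    thus ?thesis unfolding q using f1 f2 by simp linarith
  next
    case False
    hence sg: "sgn x = -1" using x by simp
    have "of_int \<lfloor>- t\<rfloor> \<le> - f" using of_int_floor_le[of "- t"] f1 by (rule order_trans[OF _ le_imp_neg_le])
    moreover have "- of_int \<lfloor>- t\<rfloor> \<le> of_int \<lfloor>t\<rfloor> + (1::real)"
    proof -
      have "t < of_int (\<lfloor>t\<rfloor> + 1)" by simp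
      hence "- (\<lfloor>t\<rfloor> + 1) \<le> \<lfloor>- t\<rfloor>" unfolding le_floor_iff by (simp only: of_int_minus)
      hence "of_int (- (\<lfloor>t\<rfloor> + 1)) \<le> (of_int \<lfloor>- t\<rfloor> :: real)" by (simp only: of_int_le_iff)
      thus ?thesis by simp
    qed
    ultimately show ?thesis unfolding q sg using f1 f2 by simp
  qed
  thus "0 \<le> sr_prob p r x" "sr_prob p r x \<le> 1" by auto
qed

end

theory Submission
  imports Defs
begin

text \<open>
  Write \<open>u = u_roundoff p\<close>, \<open>u' = u_roundoff (p + r)\<close>, \<open>c\<^sub>i = a\<^sub>i b\<^sub>i\<close> and
  \<open>A\<^sub>k = \<bar>c\<^sub>1\<bar> + \<dots> + \<bar>c\<^sub>k\<bar>\<close>. A single rounding of \<open>x\<close> yields \<open>x (1 + \<alpha> + \<beta>)\<close>, where \<open>\<beta>\<close> is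
  the deterministic relative error of the mean of the rounding and \<open>\<alpha>\<close> is the centred rest. Both
  the rounded value and its mean lie between the two neighbours of \<open>x\<close>, so \<open>\<bar>\<alpha>\<bar> \<le> u\<close>; and
  \<open>\<bar>\<beta>\<bar> \<le> u'\<close> because the mean is \<open>x\<close> truncated to \<open>p + r\<close> bits.

  Alongside the computed sums \<open>s\<^sub>k\<close>, consider the sums \<open>z\<^sub>k\<close> that are built from the same random
  \<open>\<alpha>\<close>'s, but with every \<open>\<beta>\<close> replaced by \<open>0\<close>. The error \<open>s\<^sub>n - y\<close> splits into two parts.

  The bias part \<open>s\<^sub>n - z\<^sub>n\<close> is bounded surely: an induction on \<open>k\<close> gives
  \<open>\<bar>s\<^sub>k - z\<^sub>k\<bar> \<le> A\<^sub>k ((1 + u + u')^k - (1 + u)^k)\<close>.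

  The part \<open>z\<^sub>n - y\<close> is the final value of a martingale. Hoeffding's lemma, applied to one rounding
  at a time, gives \<open>E exp (l (z\<^sub>k - (c\<^sub>1 + \<dots> + c\<^sub>k))) \<le> exp (l\<^sup>2 V\<^sub>k / 2)\<close> with
  \<open>V\<^sub>k = u\<^sup>2 A\<^sub>k\<^sup>2 (1 + (1 + u)^2 + \<dots> + (1 + u)^(2 (k - 1)))\<close>. The geometric sum equals
  \<open>gamma_err (2 * k) u / (u * (2 + u))\<close>, whence \<open>V\<^sub>n \<le> A\<^sub>n\<^sup>2 u gamma_err (2 * n) u / 2\<close>, and Chernoff's
  inequality for both tails yields the square root term. Dividing by \<open>\<bar>y\<bar>\<close> turns \<open>A\<^sub>n\<close> into the
  condition number.
\<close>

section \<open>The error of a single rounding\<close>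

lemma u_roundoff_pos: "u_roundoff q > 0"
  by (simp add: u_roundoff_def)

lemma ulp_eq: "ulp q x = u_roundoff q * 2 powi fp_exponent x"
  unfolding ulp_def u_roundoff_def by (simp add: power_int_add[symmetric] algebra_simps)

lemma ulp_le:
  assumes "x \<noteq> 0"
  shows "ulp q x \<le> u_roundoff q * \<bar>x\<bar>"
proof -
  have "2 powi fp_exponent x \<le> \<bar>x\<bar>"
    using fp_decomposition(2)[OF assms] by (simp add: fp_significand_def le_divide_eq)
  thus ?thesis
    unfolding ulp_eq using u_roundoff_pos[of q] by (intro mult_left_mono) auto
qed

lemma abs_fl_trunc_diff_le:
  assumes q: "q \<ge> 1" and x: "x \<noteq> 0"
  shows "\<bar>fl_trunc q x - x\<bar> \<le> u_roundoff q * \<bar>x\<bar>"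
proof -
  define m where "m = fp_significand x * 2 ^ (q - 1)"
  have "(2::real) ^ (q - 1) = 2 powi (int q - 1)"
    using q by (simp add: power_int_def nat_diff_distrib)
  hence "(2::real) powi fp_exponent x = ulp q x * 2 ^ (q - 1)"
    unfolding ulp_def by (simp add: power_int_add[symmetric])
  hence fl: "fl_trunc q x = sgn x * of_int \<lfloor>m\<rfloor> * ulp q x"
    using x by (simp add: fl_trunc_def m_def)
  have "x = sgn x * m * ulp q x"
    using div_ulp[OF q x] ulp_pos[of q x] unfolding m_def by (simp add: divide_eq_eq)
  hence "fl_trunc q x - x = sgn x * (of_int \<lfloor>m\<rfloor> - m) * ulp q x"
    unfolding fl by (simp add: algebra_simps)
  hence "\<bar>fl_trunc q x - x\<bar> = \<bar>of_int \<lfloor>m\<rfloor> - m\<bar> * ulp q x"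
    using x ulp_pos[of q x] by (simp add: abs_mult abs_sgn_eq)
  also have "\<dots> \<le> 1 * ulp q x"
    using ulp_pos[of q x] by (intro mult_right_mono) linarith+
  finally show ?thesis using ulp_le[OF x, of q] by simp
qed

text \<open>For \<open>x \<noteq> 0\<close>, either \<open>x\<close> is exactly representable or its two neighbours are one ulp apart.\<close>

lemma floor_ceil_fp_cases:
  assumes p: "p \<ge> 1" and x: "x \<noteq> 0"
  obtains "floor_fp p x = x" "ceil_fp p x = x"
    | "floor_fp p x \<le> x" "x \<le> ceil_fp p x" "ceil_fp p x = floor_fp p x + ulp p x"
proof (cases "x / ulp p x \<in> \<int>")
  case True
  then obtain k where k: "x / ulp p x = of_int k" by (auto elim: Ints_cases)
  have "of_int k * ulp p x = x"
    using k ulp_pos[of p x] by (simp add: divide_eq_eq)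
  hence "floor_fp p x = x" "ceil_fp p x = x"
    unfolding floor_fp_eq[OF p x] ceil_fp_eq[OF p x] k by simp_all
  thus ?thesis by (rule that(1))
next
  case False
  have w: "ulp p x > 0" by (rule ulp_pos)
  have "floor_fp p x \<le> x / ulp p x * ulp p x"
    unfolding floor_fp_eq[OF p x] using w by (intro mult_right_mono) auto
  moreover have "x / ulp p x * ulp p x \<le> ceil_fp p x"
    unfolding ceil_fp_eq[OF p x] using w by (intro mult_right_mono) auto
  moreover have "ceil_fp p x = floor_fp p x + ulp p x"
    unfolding floor_fp_eq[OF p x] ceil_fp_eq[OF p x] using False
    by (simp add: ceiling_altdef algebra_simps Ints_def) (metis rangeI)
  ultimately show ?thesis using w by (intro that(2)) auto
qed

text \<open>
  The mean of a rounding. For \<open>p \<ge> 1\<close> it equals \<open>fl_trunc (p + r) x\<close>; taking the expectation itself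
  as the definition makes the noise below centred by construction.
\<close>

definition sr_mean :: "nat \<Rightarrow> nat \<Rightarrow> real \<Rightarrow> real" where
  "sr_mean p r x = measure_pmf.expectation (SR p r x) (\<lambda>v. v)"

lemma sr_mean_eq:
  assumes "p \<ge> 1" and "x \<noteq> 0"
  shows "sr_mean p r x = floor_fp p x + sr_prob p r x * (ceil_fp p x - floor_fp p x)"
  using assms sr_prob_bounds[OF assms, of r]
  by (simp add: sr_mean_def SR_def algebra_simps)

lemma set_pmf_SR_subset: "x \<noteq> 0 \<Longrightarrow> set_pmf (SR p r x) \<subseteq> {floor_fp p x, ceil_fp p x}"
  by (auto simp: SR_def)

lemma finite_set_pmf_SR: "finite (set_pmf (SR p r x))"
  by (auto simp: SR_def)

text \<open>
  The relative errors \<open>\<alpha>\<close> (for the outcome \<open>v\<close>) and \<open>\<beta>\<close> of a rounding of \<open>x\<close>. Both are \<open>0\<close> for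
  \<open>x = 0\<close>, by the convention on division by zero.
\<close>

definition sr_noise :: "nat \<Rightarrow> nat \<Rightarrow> real \<Rightarrow> real \<Rightarrow> real" where
  "sr_noise p r x v = (v - sr_mean p r x) / x"

definition sr_bias :: "nat \<Rightarrow> nat \<Rightarrow> real \<Rightarrow> real" where
  "sr_bias p r x = (sr_mean p r x - x) / x"

lemma SR_outcome_eq:
  assumes "v \<in> set_pmf (SR p r x)"
  shows "v = x * (1 + sr_noise p r x v + sr_bias p r x)"
proof (cases "x = 0")
  case True
  thus ?thesis using assms by (simp add: SR_def)
qed (simp add: sr_noise_def sr_bias_def field_simps)

lemma abs_sr_bias_le:
  assumes p: "p \<ge> 1"
  shows "\<bar>sr_bias p r x\<bar> \<le> u_roundoff (p + r)"
proof (cases "x = 0")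
  case True
  thus ?thesis using u_roundoff_pos[of "p + r"] by (simp add: sr_bias_def)
next
  case x: False
  have "\<bar>sr_mean p r x - x\<bar> \<le> u_roundoff (p + r) * \<bar>x\<bar>"
  proof (rule floor_ceil_fp_cases[OF p x])
    assume "floor_fp p x = x" "ceil_fp p x = x"
    thus ?thesis using u_roundoff_pos[of "p + r"] by (simp add: sr_mean_eq[OF p x])
  next
    assume "ceil_fp p x = floor_fp p x + ulp p x"
    hence "sr_mean p r x = fl_trunc (p + r) x"
      using ulp_pos[of p x] by (simp add: sr_mean_eq[OF p x] sr_prob_def)
    thus ?thesis using abs_fl_trunc_diff_le[of "p + r" x] p x by simp
  qed
  thus ?thesis using x by (simp add: sr_bias_def divide_le_eq)
qed

lemma abs_sr_noise_le:
  assumes p: "p \<ge> 1" and v: "v \<in> set_pmf (SR p r x)"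
  shows "\<bar>sr_noise p r x v\<bar> \<le> u_roundoff p"
proof (cases "x = 0")
  case True
  thus ?thesis using u_roundoff_pos[of p] by (simp add: sr_noise_def)
next
  case x: False
  define f g q where "f = floor_fp p x" and "g = ceil_fp p x" and "q = sr_prob p r x"
  have q: "0 \<le> q" "q \<le> 1" using sr_prob_bounds[OF p x] by (auto simp: q_def)
  have gap: "f \<le> g" "g - f \<le> ulp p x"
    using floor_ceil_fp_cases[OF p x] ulp_pos[of p x] unfolding f_def g_def by fastforce+
  have m: "sr_mean p r x = f + q * (g - f)"
    unfolding f_def g_def q_def by (rule sr_mean_eq[OF p x])
  have "0 \<le> q * (g - f)" "q * (g - f) \<le> 1 * (g - f)"
    using q gap mult_right_mono[of q 1 "g - f"] by auto
  moreover have "v = f \<or> v = g" using set_pmf_SR_subset[OF x] v unfolding f_def g_def by blast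
  ultimately have "\<bar>v - sr_mean p r x\<bar> \<le> ulp p x"
    using gap unfolding m by auto
  also have "\<dots> \<le> u_roundoff p * \<bar>x\<bar>" by (rule ulp_le[OF x])
  finally show ?thesis using x by (simp add: sr_noise_def divide_le_eq)
qed

text \<open>
  Hoeffding's lemma is applied to \<open>l * sr_noise p r x v\<close> with exponent \<open>1\<close>, so that \<open>l\<close> may have
  either sign.
\<close>

lemma sr_noise_mgf:
  assumes p: "p \<ge> 1"
  shows "(\<integral>\<^sup>+v. ennreal (exp (l * sr_noise p r x v)) \<partial>SR p r x)
           \<le> ennreal (exp (l\<^sup>2 * (u_roundoff p)\<^sup>2 / 2))"
proof -
  define f where "f = (\<lambda>v. l * sr_noise p r x v)"
  define b where "b = \<bar>l\<bar> * u_roundoff p"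
  interpret interval_bounded_random_variable "measure_pmf (SR p r x)" f "- b" b
  proof
    have "\<bar>f v\<bar> \<le> b" if "v \<in> set_pmf (SR p r x)" for v
      unfolding f_def b_def abs_mult
      using abs_sr_noise_le[OF p that] by (intro mult_left_mono) auto
    thus "AE v in measure_pmf (SR p r x). f v \<in> {- b..b}"
      by (auto simp: AE_measure_pmf_iff abs_le_iff minus_le_iff)
  qed simp
  have "measure_pmf.expectation (SR p r x) f = 0"
    unfolding f_def sr_noise_def
    by (simp add: integrable_measure_pmf_finite[OF finite_set_pmf_SR] sr_mean_def)
  from Hoeffdings_lemma_nn_integral_0[OF zero_less_one this]
  show ?thesis by (simp add: f_def b_def power2_eq_square algebra_simps)
qed

section \<open>The computed sums coupled with the unbiased sums\<close>

text \<open>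
  The joint law of \<open>(s\<^sub>k, z\<^sub>k)\<close> for the summands \<open>c 1, \<dots>, c k\<close>: the first component is the computed
  partial sum, the second one is obtained from the same roundings by dropping the bias of each.
  The value at \<open>k = 0\<close> is a dummy.
\<close>

fun sr_coupled_sum :: "nat \<Rightarrow> nat \<Rightarrow> (nat \<Rightarrow> real) \<Rightarrow> nat \<Rightarrow> (real \<times> real) pmf" where
  "sr_coupled_sum p r c 0 = return_pmf (0, 0)"
| "sr_coupled_sum p r c (Suc 0) =
     map_pmf (\<lambda>t. (t, c 1 * (1 + sr_noise p r (c 1) t))) (SR p r (c 1))"
| "sr_coupled_sum p r c (Suc (Suc k)) =
     do {
       (s, z) \<leftarrow> sr_coupled_sum p r c (Suc k);
       t \<leftarrow> SR p r (c (Suc (Suc k)));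
       v \<leftarrow> SR p r (s + t);
       return_pmf (v, (z + c (Suc (Suc k)) * (1 + sr_noise p r (c (Suc (Suc k))) t))
                        * (1 + sr_noise p r (s + t) v))
     }"

lemma map_fst_sr_coupled_sum:
  "map_pmf fst (sr_coupled_sum p r (hadamard a b) k) = sr_partial_sum p r a b k"
proof (induction p r a b k rule: sr_partial_sum.induct)
  case (3 p r a b k)
  show ?case
    unfolding sr_partial_sum.simps "3.IH"[symmetric] bind_map_pmf
    by (simp add: map_bind_pmf case_prod_unfold hadamard_def bind_return_pmf')
qed (simp_all add: map_pmf_comp hadamard_def)

lemma sr_coupled_sum_SucE:
  assumes "k \<ge> 1" and "sz \<in> set_pmf (sr_coupled_sum p r c (Suc k))"
  obtains s z t v where "(s, z) \<in> set_pmf (sr_coupled_sum p r c k)"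
    "t \<in> set_pmf (SR p r (c (Suc k)))" "v \<in> set_pmf (SR p r (s + t))"
    "sz = (v, (z + c (Suc k) * (1 + sr_noise p r (c (Suc k)) t)) * (1 + sr_noise p r (s + t) v))"
  using assms by (cases k) auto

section \<open>The bias part of the error\<close>

lemma abs_mult_one_plus_le:
  fixes x d :: real
  assumes "\<bar>x\<bar> \<le> B" and "\<bar>d\<bar> \<le> e"
  shows "\<bar>x * (1 + d)\<bar> \<le> B * (1 + e)"
  unfolding abs_mult using assms by (intro mult_mono) auto

text \<open>
  Every product \<open>c i\<close> passes through at most \<open>k\<close> roundings on its way into the \<open>k\<close>-th sum. For the
  difference, the step uses
  \<open>(s + t) (1 + \<alpha> + \<beta>) - (z + t') (1 + \<alpha>) = ((s - z) + (t - t')) (1 + \<alpha> + \<beta>) + (z + t') \<beta>\<close>,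
  where \<open>t\<close> and \<open>t'\<close> are the rounded product with and without its bias.
\<close>

lemma sr_coupled_sum_bounds:
  assumes p: "p \<ge> 1" and "k \<ge> 1" and "(s, z) \<in> set_pmf (sr_coupled_sum p r c k)"
  defines "u \<equiv> u_roundoff p" and "u' \<equiv> u_roundoff (p + r)"
  shows "\<bar>z\<bar> \<le> (\<Sum>i=1..k. \<bar>c i\<bar>) * (1 + u) ^ k
       \<and> \<bar>s - z\<bar> \<le> (\<Sum>i=1..k. \<bar>c i\<bar>) * ((1 + u + u') ^ k - (1 + u) ^ k)"
  using assms(2,3)
proof (induction k arbitrary: s z rule: nat_induct_at_least)
  case base
  then obtain t where t: "t \<in> set_pmf (SR p r (c 1))" "s = t"
      "z = c 1 * (1 + sr_noise p r (c 1) t)"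
    by auto
  have "s - z = c 1 * sr_bias p r (c 1)"
    using SR_outcome_eq[OF t(1)] unfolding t(2,3) by (simp add: algebra_simps)
  moreover have "\<bar>c 1 * sr_bias p r (c 1)\<bar> \<le> \<bar>c 1\<bar> * u'"
    unfolding abs_mult u'_def using abs_sr_bias_le[OF p] by (intro mult_left_mono) auto
  moreover have "\<bar>z\<bar> \<le> \<bar>c 1\<bar> * (1 + u)"
    unfolding t(3) u_def by (intro abs_mult_one_plus_le abs_sr_noise_le[OF p t(1)]) auto
  ultimately show ?case by simp
next
  case (Suc k)
  obtain s0 z0 t v where h: "(s0, z0) \<in> set_pmf (sr_coupled_sum p r c k)"
    "t \<in> set_pmf (SR p r (c (Suc k)))" "v \<in> set_pmf (SR p r (s0 + t))"
    "(s, z) = (v, (z0 + c (Suc k) * (1 + sr_noise p r (c (Suc k)) t)) * (1 + sr_noise p r (s0 + t) v))"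
    using sr_coupled_sum_SucE[OF Suc.hyps Suc.prems] by blast
  define C where "C = \<bar>c (Suc k)\<bar>"
  define A where "A = (\<Sum>i=1..k. \<bar>c i\<bar>)"
  define t' where "t' = c (Suc k) * (1 + sr_noise p r (c (Suc k)) t)"
  define al where "al = sr_noise p r (s0 + t) v"
  define be where "be = sr_bias p r (s0 + t)"
  define D where "D = (1 + u + u') ^ k - (1 + u) ^ k"
  have u: "u > 0" "u' > 0" unfolding u_def u'_def by (rule u_roundoff_pos)+
  have A: "(\<Sum>i=1..Suc k. \<bar>c i\<bar>) = A + C" by (simp add: A_def C_def)
  have A0: "A \<ge> 0" "C \<ge> 0" by (auto simp: A_def C_def intro: sum_nonneg)
  have IH: "\<bar>z0\<bar> \<le> A * (1 + u) ^ k" "\<bar>s0 - z0\<bar> \<le> A * D"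
    using Suc.IH[OF h(1)] unfolding A_def D_def by auto
  have al: "\<bar>al\<bar> \<le> u" unfolding al_def u_def by (rule abs_sr_noise_le[OF p h(3)])
  have be: "\<bar>be\<bar> \<le> u'" unfolding be_def u'_def by (rule abs_sr_bias_le[OF p])
  have s: "s = (s0 + t) * (1 + al + be)"
    using SR_outcome_eq[OF h(3)] h(4) unfolding al_def be_def by simp
  have z: "z = (z0 + t') * (1 + al)" using h(4) by (simp add: t'_def al_def)

  have "\<bar>t'\<bar> \<le> C * (1 + u)"
    unfolding t'_def u_def C_def by (intro abs_mult_one_plus_le abs_sr_noise_le[OF p h(2)]) auto
  also have "\<dots> \<le> C * (1 + u) ^ k"
    using u A0 Suc.hyps by (intro mult_left_mono self_le_power) auto
  finally have zt: "\<bar>z0 + t'\<bar> \<le> (A + C) * (1 + u) ^ k"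
    using IH(1) by (simp add: algebra_simps)

  \<comment> \<open>The bias of the new product is also dominated by \<open>D\<close>, since \<open>D\<close> grows with \<open>k\<close> and equals
    \<open>u'\<close> for \<open>k = 1\<close>.\<close>
  have "u' \<le> D"
    using Suc.hyps unfolding D_def
  proof (induction k rule: nat_induct_at_least)
    case (Suc k)
    have "(1 + u) * u' \<le> (1 + u) * ((1 + u + u') ^ k - (1 + u) ^ k)"
      using Suc.IH u by (intro mult_left_mono) auto
    moreover have "0 \<le> u' * (1 + u + u') ^ k" "0 \<le> u * u'" using u by auto
    ultimately show ?case by (simp add: algebra_simps)
  qed simp
  have "t - t' = c (Suc k) * sr_bias p r (c (Suc k))"
    using SR_outcome_eq[OF h(2)] unfolding t'_def by (simp add: algebra_simps)
  hence "\<bar>t - t'\<bar> = C * \<bar>sr_bias p r (c (Suc k))\<bar>" by (simp add: abs_mult C_def)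
  also have "\<dots> \<le> C * D"
    using abs_sr_bias_le[OF p, of r "c (Suc k)"] \<open>u' \<le> D\<close> A0
    by (intro mult_left_mono) (auto simp: u'_def)
  finally have st: "\<bar>(s0 - z0) + (t - t')\<bar> \<le> (A + C) * D"
    using IH(2) by (simp add: algebra_simps)

  have "s - z = ((s0 - z0) + (t - t')) * (1 + (al + be)) + (z0 + t') * be"
    unfolding s z by (simp add: algebra_simps)
  also have "\<bar>\<dots>\<bar> \<le> (A + C) * D * (1 + (u + u')) + (A + C) * (1 + u) ^ k * u'"
  proof (rule order_trans[OF abs_triangle_ineq], rule add_mono)
    show "\<bar>((s0 - z0) + (t - t')) * (1 + (al + be))\<bar> \<le> (A + C) * D * (1 + (u + u'))"
      using al be by (intro abs_mult_one_plus_le st) linarith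
    show "\<bar>(z0 + t') * be\<bar> \<le> (A + C) * (1 + u) ^ k * u'"
      unfolding abs_mult[of _ be] using zt be u A0 by (intro mult_mono) auto
  qed
  also have "\<dots> = (A + C) * ((1 + u + u') ^ Suc k - (1 + u) ^ Suc k)"
    by (simp add: D_def algebra_simps)
  finally have "\<bar>s - z\<bar> \<le> (A + C) * ((1 + u + u') ^ Suc k - (1 + u) ^ Suc k)" .
  moreover have "\<bar>z\<bar> \<le> (A + C) * (1 + u) ^ k * (1 + u)"
    unfolding z by (intro abs_mult_one_plus_le zt al)
  ultimately show ?case unfolding A by (simp add: mult_ac)
qed

section \<open>The martingale part of the error\<close>

text \<open>
  For a rounding of a partial sum, \<open>x\<close> is the computed value and \<open>w\<close> its counterpart without bias.
\<close>

lemma one_rounding_mgf: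
  assumes p: "p \<ge> 1" and w: "\<bar>w\<bar> \<le> B"
  shows "(\<integral>\<^sup>+v. ennreal (exp (l * (w * (1 + sr_noise p r x v) - y))) \<partial>SR p r x)
           \<le> ennreal (exp (l\<^sup>2 * ((u_roundoff p)\<^sup>2 * B\<^sup>2) / 2)) * ennreal (exp (l * (w - y)))"
proof -
  let ?u = "u_roundoff p"
  have "(\<integral>\<^sup>+v. ennreal (exp (l * (w * (1 + sr_noise p r x v) - y))) \<partial>SR p r x)
      = (\<integral>\<^sup>+v. ennreal (exp (l * (w - y))) * ennreal (exp ((l * w) * sr_noise p r x v)) \<partial>SR p r x)"
    by (intro nn_integral_cong) (simp add: ennreal_mult[symmetric] exp_add[symmetric] algebra_simps)
  also have "\<dots> = ennreal (exp (l * (w - y)))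
                  * (\<integral>\<^sup>+v. ennreal (exp ((l * w) * sr_noise p r x v)) \<partial>SR p r x)"
    by (rule nn_integral_cmult) simp
  also have "\<dots> \<le> ennreal (exp (l * (w - y))) * ennreal (exp ((l * w)\<^sup>2 * ?u\<^sup>2 / 2))"
    by (intro mult_left_mono sr_noise_mgf[OF p]) auto
  also have "\<dots> \<le> ennreal (exp (l * (w - y))) * ennreal (exp (l\<^sup>2 * (?u\<^sup>2 * B\<^sup>2) / 2))"
  proof (intro mult_left_mono ennreal_leI)
    have "w\<^sup>2 \<le> B\<^sup>2" using w by (simp add: abs_le_square_iff[symmetric])
    hence "l\<^sup>2 * ?u\<^sup>2 * w\<^sup>2 \<le> l\<^sup>2 * ?u\<^sup>2 * B\<^sup>2" by (intro mult_left_mono) auto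
    thus "exp ((l * w)\<^sup>2 * ?u\<^sup>2 / 2) \<le> exp (l\<^sup>2 * (?u\<^sup>2 * B\<^sup>2) / 2)"
      by (simp add: power_mult_distrib mult_ac)
  qed auto
  finally show ?thesis by (simp only: mult.commute)
qed

text \<open>
  Adding the next product multiplies the bound by one factor for the rounding of that product and
  by one for the rounding of the sum; the latter uses the sure bound on \<open>z\<^sub>k\<close>.
\<close>

lemma sr_coupled_sum_mgf:
  assumes p: "p \<ge> 1" and "k \<ge> 1"
  defines "u \<equiv> u_roundoff p"
  shows "(\<integral>\<^sup>+sz. ennreal (exp (l * (snd sz - (\<Sum>i=1..k. c i)))) \<partial>sr_coupled_sum p r c k)
    \<le> ennreal (exp (l\<^sup>2 * (u\<^sup>2 * ((\<Sum>i=1..k. \<bar>c i\<bar>)\<^sup>2 * (\<Sum>j<k. (1 + u) ^ (2 * j)))) / 2))"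
  using assms(2)
proof (induction k rule: nat_induct_at_least)
  case base
  show ?case
    using one_rounding_mgf[OF p, where l = l and w = "c 1" and B = "\<bar>c 1\<bar>"
        and r = r and x = "c 1" and y = "c 1"]
    by (simp add: u_def)
next
  case (Suc k)
  define M where "M = sr_coupled_sum p r c k"
  define C where "C = c (Suc k)"
  define Y where "Y = (\<Sum>i=1..k. c i)"
  define A where "A = (\<Sum>i=1..k. \<bar>c i\<bar>)"
  define G where "G = (\<Sum>j<k. (1 + u) ^ (2 * j))"
  define B where "B = (A + \<bar>C\<bar>) * (1 + u) ^ k"
  define K1 where "K1 = exp (l\<^sup>2 * (u\<^sup>2 * \<bar>C\<bar>\<^sup>2) / 2)"
  define K2 where "K2 = exp (l\<^sup>2 * (u\<^sup>2 * B\<^sup>2) / 2)"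
  define N where "N = sr_noise p r"
  have u: "u > 0" unfolding u_def by (rule u_roundoff_pos)
  have A0: "A \<ge> 0" unfolding A_def by (simp add: sum_nonneg)
  have A_Suc: "(\<Sum>i=1..Suc k. \<bar>c i\<bar>) = A + \<bar>C\<bar>" and Y_Suc: "(\<Sum>i=1..Suc k. c i) = Y + C"
    by (simp_all add: A_def Y_def C_def)
  have G_Suc: "(\<Sum>j<Suc k. (1 + u) ^ (2 * j)) = G + ((1 + u) ^ k)\<^sup>2"
    by (simp add: G_def power_even_eq)
  have G1: "1 \<le> G"
  proof -
    have "(1 + u) ^ (2 * 0) \<le> G"
      unfolding G_def using Suc.hyps u by (intro member_le_sum) auto
    thus ?thesis by simp
  qed

  have sum_step: "(\<integral>\<^sup>+v. ennreal (exp (l * ((z + C * (1 + N C t)) * (1 + N (s + t) v) - (Y + C)))) \<partial>SR p r (s + t))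
      \<le> ennreal K2 * ennreal (exp (l * (C * (1 + N C t) - (Y + C - z))))"
    if sz: "(s, z) \<in> set_pmf M" and t: "t \<in> set_pmf (SR p r C)" for s z t
  proof -
    have "\<bar>C * (1 + N C t)\<bar> \<le> \<bar>C\<bar> * (1 + u)"
      unfolding u_def N_def by (intro abs_mult_one_plus_le abs_sr_noise_le[OF p t]) auto
    also have "\<dots> \<le> \<bar>C\<bar> * (1 + u) ^ k"
      using u Suc.hyps by (intro mult_left_mono self_le_power) auto
    finally have "\<bar>z + C * (1 + N C t)\<bar> \<le> B"
      using conjunct1[OF sr_coupled_sum_bounds[OF p Suc.hyps sz[unfolded M_def]]]
      unfolding B_def A_def[symmetric] u_def[symmetric] distrib_right by linarith
    from one_rounding_mgf[OF p this, where l = l and r = r and x = "s + t" and y = "Y + C"]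
    show ?thesis unfolding N_def K2_def u_def by (simp add: algebra_simps)
  qed
  have prod_step: "(\<integral>\<^sup>+t. ennreal (exp (l * (C * (1 + N C t) - (Y + C - z)))) \<partial>SR p r C)
      \<le> ennreal K1 * ennreal (exp (l * (z - Y)))" for z
    using one_rounding_mgf[OF p order_refl, where l = l and w = C and r = r and x = C and y = "Y + C - z"]
    unfolding N_def K1_def u_def by simp

  have "sr_coupled_sum p r c (Suc k) =
     do {
       (s, z) \<leftarrow> M;
       t \<leftarrow> SR p r C;
       v \<leftarrow> SR p r (s + t);
       return_pmf (v, (z + C * (1 + N C t)) * (1 + N (s + t) v))
     }"
    using Suc.hyps by (cases k) (simp_all add: M_def C_def N_def)
  hence "(\<integral>\<^sup>+sz. ennreal (exp (l * (snd sz - (Y + C)))) \<partial>sr_coupled_sum p r c (Suc k))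
      = (\<integral>\<^sup>+sz. \<integral>\<^sup>+t. \<integral>\<^sup>+v. ennreal (exp (l * ((snd sz + C * (1 + N C t)) * (1 + N (fst sz + t) v) - (Y + C))))
           \<partial>SR p r (fst sz + t) \<partial>SR p r C \<partial>M)"
    by (simp add: case_prod_unfold)
  also have "\<dots> \<le> (\<integral>\<^sup>+sz. \<integral>\<^sup>+t. ennreal K2 * ennreal (exp (l * (C * (1 + N C t) - (Y + C - snd sz))))
           \<partial>SR p r C \<partial>M)"
    by (intro nn_integral_mono_AE AE_pmfI sum_step) auto
  also have "\<dots> = ennreal K2 * (\<integral>\<^sup>+sz. \<integral>\<^sup>+t. ennreal (exp (l * (C * (1 + N C t) - (Y + C - snd sz))))
           \<partial>SR p r C \<partial>M)"
    by (simp add: nn_integral_cmult)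
  also have "\<dots> \<le> ennreal K2 * (\<integral>\<^sup>+sz. ennreal K1 * ennreal (exp (l * (snd sz - Y))) \<partial>M)"
    by (intro mult_left_mono nn_integral_mono prod_step) auto
  also have "\<dots> = ennreal K2 * (ennreal K1 * (\<integral>\<^sup>+sz. ennreal (exp (l * (snd sz - Y))) \<partial>M))"
    by (simp add: nn_integral_cmult)
  also have "\<dots> \<le> ennreal K2 * (ennreal K1 * ennreal (exp (l\<^sup>2 * (u\<^sup>2 * (A\<^sup>2 * G)) / 2)))"
    using Suc.IH unfolding M_def Y_def A_def G_def by (intro mult_left_mono) auto
  also have "\<dots> = ennreal (exp (l\<^sup>2 * u\<^sup>2 / 2 * (B\<^sup>2 + \<bar>C\<bar>\<^sup>2 + A\<^sup>2 * G)))"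
    unfolding K1_def K2_def by (simp add: ennreal_mult[symmetric] exp_add[symmetric] algebra_simps)
  also have "\<dots> \<le> ennreal (exp (l\<^sup>2 * u\<^sup>2 / 2 * ((A + \<bar>C\<bar>)\<^sup>2 * (G + ((1 + u) ^ k)\<^sup>2))))"
  proof -
    \<comment> \<open>As \<open>A \<ge> 0\<close> and \<open>G \<ge> 1\<close>, the contribution of the new product fits into the square of the sum.\<close>
    have "\<bar>C\<bar>\<^sup>2 * 1 \<le> \<bar>C\<bar>\<^sup>2 * G" using G1 by (intro mult_left_mono) auto
    moreover have "0 \<le> 2 * A * \<bar>C\<bar> * G" using A0 G1 by simp
    ultimately have "\<bar>C\<bar>\<^sup>2 + A\<^sup>2 * G \<le> (A + \<bar>C\<bar>)\<^sup>2 * G"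
      by (simp add: power2_sum algebra_simps)
    hence "B\<^sup>2 + \<bar>C\<bar>\<^sup>2 + A\<^sup>2 * G \<le> (A + \<bar>C\<bar>)\<^sup>2 * (G + ((1 + u) ^ k)\<^sup>2)"
      unfolding B_def power_mult_distrib by (simp only: distrib_left)
    thus ?thesis by (intro ennreal_leI iffD2[OF exp_le_cancel_iff] mult_left_mono) auto
  qed
  finally show ?case
    unfolding A_Suc Y_Suc G_Suc by (simp add: mult_ac)
qed

lemma sub_gaussian_two_sided_tail:
  fixes M :: "'a pmf" and X :: "'a \<Rightarrow> real"
  assumes mgf: "\<And>l. (\<integral>\<^sup>+x. ennreal (exp (l * X x)) \<partial>M) \<le> ennreal (exp (l\<^sup>2 * W / 2))"
    and W: "W > 0" and \<tau>: "\<tau> > 0"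
  shows "measure_pmf.prob M {x. \<bar>X x\<bar> \<ge> \<tau>} \<le> 2 * exp (- (\<tau>\<^sup>2 / (2 * W)))"
proof -
  have tail: "measure_pmf.prob M {x. Z x \<ge> \<tau>} \<le> exp (- (\<tau>\<^sup>2 / (2 * W)))"
    if Z: "\<And>l. (\<integral>\<^sup>+x. ennreal (exp (l * Z x)) \<partial>M) \<le> ennreal (exp (l\<^sup>2 * W / 2))" for Z :: "'a \<Rightarrow> real"
  proof -
    \<comment> \<open>This \<open>l\<close> minimises the exponent \<open>l\<^sup>2 W / 2 - l \<tau>\<close> in Chernoff's bound.\<close>
    define l where "l = \<tau> / W"
    have "emeasure M {x. Z x \<ge> \<tau>} \<le> ennreal (exp (- l * \<tau>)) * (\<integral>\<^sup>+x. ennreal (exp (l * Z x)) \<partial>M)"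
      using Chernoff_ineq_nn_integral_ge[of l UNIV "measure_pmf M" Z \<tau>] W \<tau> by (simp add: l_def)
    also have "\<dots> \<le> ennreal (exp (- l * \<tau>)) * ennreal (exp (l\<^sup>2 * W / 2))"
      by (intro mult_left_mono Z) auto
    also have "\<dots> = ennreal (exp (- l * \<tau> + l\<^sup>2 * W / 2))"
      by (simp add: ennreal_mult[symmetric] exp_add[symmetric])
    also have "- l * \<tau> + l\<^sup>2 * W / 2 = - (\<tau>\<^sup>2 / (2 * W))"
      using W by (simp add: l_def field_simps power2_eq_square)
    finally show ?thesis by (simp add: measure_pmf.emeasure_eq_measure)
  qed
  have "{x. \<bar>X x\<bar> \<ge> \<tau>} = {x. X x \<ge> \<tau>} \<union> {x. - X x \<ge> \<tau>}" by (auto simp: abs_if)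
  hence "measure_pmf.prob M {x. \<bar>X x\<bar> \<ge> \<tau>}
       \<le> measure_pmf.prob M {x. X x \<ge> \<tau>} + measure_pmf.prob M {x. - X x \<ge> \<tau>}"
    by (simp add: measure_Un_le)
  also have "\<dots> \<le> exp (- (\<tau>\<^sup>2 / (2 * W))) + exp (- (\<tau>\<^sup>2 / (2 * W)))"
    using mgf[of "- l" for l] by (intro add_mono tail mgf) simp_all
  finally show ?thesis by simp
qed

section \<open>The error of the inner product\<close>

lemma gamma_err_even_eq_geometric:
  "gamma_err (2 * n) u = u * (2 + u) * (\<Sum>j<n. (1 + u) ^ (2 * j))"
proof -
  have "((1 + u)\<^sup>2) ^ n - 1 = ((1 + u)\<^sup>2 - 1) * (\<Sum>j<n. ((1 + u)\<^sup>2) ^ j)"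
    by (rule power_diff_1_eq)
  thus ?thesis unfolding gamma_err_def power_mult by (simp add: power2_eq_square[of "1 + u"] algebra_simps)
qed

theorem theorem6:
  fixes p r n :: nat and a b :: "nat \<Rightarrow> real" and y lam :: real
  assumes "p \<ge> 1" and "r \<ge> 1" and "n \<ge> 1"
    and "y = (\<Sum>i=1..n. a i * b i)" and "y \<noteq> 0"
    and "0 < lam" and "lam < 1"
  shows "measure_pmf.prob (sr_inner_product p r n a b)
           {yhat. \<bar>yhat - y\<bar> / \<bar>y\<bar> \<le> cond_number n (hadamard a b) *
              (sqrt (u_roundoff p * gamma_err (2 * n) (u_roundoff p)) * sqrt (ln (2 / lam))
               + gamma_err n (u_roundoff p + u_roundoff (p + r)) - gamma_err n (u_roundoff p))}
         \<ge> 1 - lam"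
proof -
  define u u' where "u = u_roundoff p" and "u' = u_roundoff (p + r)"
  define c where "c = hadamard a b"
  define A where "A = (\<Sum>i=1..n. \<bar>c i\<bar>)"
  define M where "M = sr_coupled_sum p r c n"
  define G where "G = (\<Sum>j<n. (1 + u) ^ (2 * j))"
  define W where "W = A\<^sup>2 * (u * gamma_err (2 * n) u) / 2"
  define \<tau> where "\<tau> = A * (sqrt (u * gamma_err (2 * n) u) * sqrt (ln (2 / lam)))"
  define D where "D = (1 + u + u') ^ n - (1 + u) ^ n"
  have y: "y = (\<Sum>i=1..n. c i)" using assms(4) by (simp add: c_def hadamard_def)
  have u: "u > 0" unfolding u_def by (rule u_roundoff_pos)
  have "\<bar>y\<bar> \<le> A" unfolding y A_def by (rule sum_abs)
  hence A: "A > 0" using assms(5) by linarith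
  have "(1 + u) ^ (2 * 0) \<le> G"
    unfolding G_def using assms(3) u by (intro member_le_sum) auto
  hence G: "G > 0" by simp
  have gam: "gamma_err (2 * n) u = u * (2 + u) * G"
    unfolding G_def by (rule gamma_err_even_eq_geometric)
  hence gam_pos: "u * gamma_err (2 * n) u > 0" using u G by simp
  have W: "W > 0" unfolding W_def using A gam_pos by simp
  have L: "ln (2 / lam) > 0" using assms(6,7) by (intro ln_gt_zero) simp
  have \<tau>: "\<tau> > 0" unfolding \<tau>_def using A gam_pos L by simp

  have "u\<^sup>2 * (A\<^sup>2 * G) \<le> W"
    using u G A unfolding W_def gam by (simp add: power2_eq_square algebra_simps)
  have "(\<integral>\<^sup>+sz. ennreal (exp (l * (snd sz - y))) \<partial>M) \<le> ennreal (exp (l\<^sup>2 * W / 2))" for l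
  proof -
    have "(\<integral>\<^sup>+sz. ennreal (exp (l * (snd sz - y))) \<partial>M) \<le> ennreal (exp (l\<^sup>2 * (u\<^sup>2 * (A\<^sup>2 * G)) / 2))"
      unfolding M_def y A_def G_def u_def by (rule sr_coupled_sum_mgf[OF assms(1,3)])
    also have "\<dots> \<le> ennreal (exp (l\<^sup>2 * W / 2))"
      using \<open>u\<^sup>2 * (A\<^sup>2 * G) \<le> W\<close> by (simp add: mult_left_mono)
    finally show ?thesis .
  qed
  from sub_gaussian_two_sided_tail[OF this W \<tau>]
  have "measure_pmf.prob M {sz. \<bar>snd sz - y\<bar> \<ge> \<tau>} \<le> 2 * exp (- (\<tau>\<^sup>2 / (2 * W)))" .
  also have "\<tau>\<^sup>2 / (2 * W) = ln (2 / lam)"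
    unfolding \<tau>_def W_def using A gam_pos L by (auto simp: power_mult_distrib)
  also have "2 * exp (- ln (2 / lam)) = lam"
    using assms(6) by (simp add: exp_minus)
  finally have tail: "measure_pmf.prob M {sz. \<bar>snd sz - y\<bar> \<ge> \<tau>} \<le> lam" .

  define R where "R = cond_number n c * (sqrt (u * gamma_err (2 * n) u) * sqrt (ln (2 / lam))
               + gamma_err n (u + u') - gamma_err n u)"
  have R: "R = (\<tau> + A * D) / \<bar>y\<bar>"
    unfolding R_def cond_number_def y[symmetric] A_def[symmetric] \<tau>_def D_def gamma_err_def
    by (simp add: field_simps)
  have "1 - lam \<le> 1 - measure_pmf.prob M {sz. \<bar>snd sz - y\<bar> \<ge> \<tau>}" using tail by simp
  also have "\<dots> = measure_pmf.prob M (- {sz. \<bar>snd sz - y\<bar> \<ge> \<tau>})"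
    using measure_pmf.prob_compl[of "{sz. \<bar>snd sz - y\<bar> \<ge> \<tau>}" M] by (simp add: Compl_eq_Diff_UNIV)
  also have "\<dots> \<le> measure_pmf.prob M {sz. \<bar>fst sz - y\<bar> / \<bar>y\<bar> \<le> R}"
  proof (rule measure_pmf.finite_measure_mono_AE)
    have "\<bar>s - y\<bar> / \<bar>y\<bar> \<le> R" if "(s, z) \<in> set_pmf M" "\<bar>z - y\<bar> < \<tau>" for s z
    proof -
      have "\<bar>s - z\<bar> \<le> A * D"
        using sr_coupled_sum_bounds[OF assms(1,3) that(1)[unfolded M_def]]
        unfolding A_def D_def u_def u'_def by simp
      hence "\<bar>s - y\<bar> \<le> \<tau> + A * D" using that(2) by linarith
      thus ?thesis unfolding R by (rule divide_right_mono) simp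
    qed
    thus "AE sz in measure_pmf M. sz \<in> - {sz. \<bar>snd sz - y\<bar> \<ge> \<tau>} \<longrightarrow> sz \<in> {sz. \<bar>fst sz - y\<bar> / \<bar>y\<bar> \<le> R}"
      by (auto simp: AE_measure_pmf_iff not_le)
  qed simp
  also have "\<dots> = measure_pmf.prob (map_pmf fst M) {yhat. \<bar>yhat - y\<bar> / \<bar>y\<bar> \<le> R}"
    by (simp add: vimage_def)
  also have "map_pmf fst M = sr_inner_product p r n a b"
    unfolding M_def c_def sr_inner_product_def by (rule map_fst_sr_coupled_sum)
  finally show ?thesis unfolding R_def c_def u_def u'_def .
qed

end
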